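(* Let $w^o$ be the unique minimizer over $\mathbb{R}^M$ of $\sum_{k=1}^N p_k\{J_k(w)+R_k(w)\}$ and, for $\delta>0$, let $w_\delta^o$ be the unique minimizer over $\mathbb{R}^M$ of the smoothed cost $\sum_{k=1}^N p_k\{J_k(w)+R_k^\delta(w)\}$. Then there exist subgradients $r_k^o\in\partial R_k(w^o)$, $k=1,\dots,N$, such that $$\sum_{k=1}^N p_k\{\nabla J_k(w^o)+r_k^o\}=0,$$ and for any such collection $\{r_k^o\}$ and every $\delta>0$, $$\|w^o-w_\delta^o\|^2\le \delta\cdot\frac{2}{\lambda_L}\sum_{k=1}^N p_k\, d(r_k^o).$$ In particular $\|w^o-w_\delta^o\|^2=O(\delta)$: the bias introduced by smoothing diminishes linearly with $\delta$.
   Context: $\|\cdot\|$ is the Euclidean norm. $N,M\ge 1$ are integers and $p_1,\dots,p_N>0$ are weights with $\sum_k p_k=1$. Standing assumptions. For each $k$, $J_k:\mathbb{R}^M\to\mathbb{R}$ is differentiable with Lipschitz gradient: $\|\nabla J_k(x)-\nabla J_k(y)\|\le\lambda_U\|x-y\|$ for all $x,y\in\mathbb{R}^M$. The weighted aggregate of the $J_k$ is strongly convex: there is $\lambda_L>0$ with $(x-y)^{\mathsf T}\sum_{k=1}^N p_k(\nabla J_k(x)-\nabla J_k(y))\ge\lambda_L\|x-y\|^2$ for all $x,y$. For each $k$, $R_k:\mathbb{R}^M\to\mathbb{R}$ is closed convex (convex with closed sublevel sets), not necessarily differentiable. Smoothing. The conjugate of $R_k$ is $R_k^\star(w)=\sup_{u\in\mathrm{dom}\,R_k}\{w^{\mathsf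 T}u-R_k(u)\}$, and $\mathrm{dom}\,R_k^\star$ is the set where it is finite. The function $d$ is a proximity function for each of the sets $C=\mathrm{dom}\,R_k^\star$, $k=1,\dots,N$, meaning: $d$ is continuous and strongly convex with strong-convexity constant one, $C\subseteq\mathrm{dom}\,d$, $\min_{w\in C}d(w)=0$, $\arg\min_{w\in C}d(w)=0$ (so $0\in C$), and $d(w)\ge\frac12\|w\|^2$. For $\delta>0$ the smooth approximation of $R_k$ is $$R_k^\delta(w)=\max_{u\in\mathrm{dom}\,R_k^\star}\{w^{\mathsf T}u-R_k^\star(u)-\delta\, d(u)\},$$ which is a convex differentiable function on $\mathbb{R}^M$. *)

theory Defs
  imports "HOL-Analysis.Analysis" "HOL-Library.Landau_Symbols"
begin

definition subdifferential :: "('a::real_inner \<Rightarrow> real) \<Rightarrow> 'a \<Rightarrow> 'a set" where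
  "subdifferential f x = {g. \<forall>y. f y \<ge> f x + g \<bullet> (y - x)}"

definition closed_convex_fun :: "('a::real_inner \<Rightarrow> real) \<Rightarrow> bool" where
  "closed_convex_fun f \<longleftrightarrow> convex_on UNIV f \<and> (\<forall>a. closed {x. f x \<le> a})"

definition strongly_convex_on :: "real \<Rightarrow> 'a::real_inner set \<Rightarrow> ('a \<Rightarrow> real) \<Rightarrow> bool" where
  "strongly_convex_on \<mu> D f \<longleftrightarrow> convex D \<and>
     (\<forall>x\<in>D. \<forall>y\<in>D. \<forall>t\<in>{0..1}.
        f ((1 - t) *\<^sub>R x + t *\<^sub>R y)
          \<le> (1 - t) * f x + t * f y - \<mu> / 2 * t * (1 - t) * (norm (x - y))\<^sup>2)"

text \<open>The functions that are conjugated are real-valued on the whole space, so the supremum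
  ranges over all points; the conjugate itself may take the value \<open>\<infinity>\<close>.\<close>

definition conjugate :: "('a::real_inner \<Rightarrow> real) \<Rightarrow> 'a \<Rightarrow> ereal" where
  "conjugate f w = (SUP u. ereal (w \<bullet> u - f u))"

definition edom :: "('a \<Rightarrow> ereal) \<Rightarrow> 'a set" where
  "edom f = {x. \<bar>f x\<bar> \<noteq> \<infinity>}"

text \<open>A function \<open>d\<close> with domain \<open>D\<close> is represented by a total real-valued function whose values
  outside \<open>D\<close> are irrelevant. The condition on \<open>is_arg_min\<close> says that \<open>0\<close> belongs to \<open>C\<close> and is
  the only minimizer of \<open>d\<close> over \<open>C\<close>.\<close>

definition prox_function :: "('a::real_inner \<Rightarrow> real) \<Rightarrow> 'a set \<Rightarrow> 'a set \<Rightarrow> bool" where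
  "prox_function d D C \<longleftrightarrow>
     continuous_on D d \<and> strongly_convex_on 1 D d \<and> C \<subseteq> D \<and>
     d 0 = 0 \<and> (\<forall>w. is_arg_min d (\<lambda>u. u \<in> C) w \<longleftrightarrow> w = 0) \<and>
     (\<forall>w\<in>C. d w \<ge> 1 / 2 * (norm w)\<^sup>2)"

definition smoothed :: "('a::real_inner \<Rightarrow> real) \<Rightarrow> real \<Rightarrow> ('a \<Rightarrow> real) \<Rightarrow> 'a \<Rightarrow> real" where
  "smoothed d \<delta> f w =
     (SUP u\<in>edom (conjugate f). w \<bullet> u - real_of_ereal (conjugate f u) - \<delta> * d u)"

lemma conjugate_ge: "ereal (u \<bullet> v - f v) \<le> conjugate f u"
  unfolding conjugate_def by (rule SUP_upper) simp

lemma conjugate_leI: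
  assumes "\<And>v. u \<bullet> v - f v \<le> a"
  shows "conjugate f u \<le> ereal a"
  unfolding conjugate_def by (rule SUP_least) (simp add: assms)

lemma edom_conjugateI:
  assumes "\<And>v. u \<bullet> v - f v \<le> a"
  shows "u \<in> edom (conjugate f)" and "real_of_ereal (conjugate f u) \<le> a"
proof -
  have "conjugate f u \<le> ereal a" by (rule conjugate_leI) (rule assms)
  moreover have "ereal (u \<bullet> 0 - f 0) \<le> conjugate f u" by (rule conjugate_ge)
  ultimately show "u \<in> edom (conjugate f)" "real_of_ereal (conjugate f u) \<le> a"
    by (cases "conjugate f u"; auto simp: edom_def)+
qed

lemma real_conjugate_ge:
  assumes "u \<in> edom (conjugate f)"
  shows "u \<bullet> v - f v \<le> real_of_ereal (conjugate f u)"
  using conjugate_ge[of u v f] assms by (cases "conjugate f u") (auto simp: edom_def)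

text \<open>For a proximity function, the supremum defining \<^const>\<open>smoothed\<close> is a maximum.\<close>

lemma smoothed_attained:
  fixes f :: "'a::euclidean_space \<Rightarrow> real"
  assumes d: "prox_function d D (edom (conjugate f))" and "\<delta> > 0"
  defines "h \<equiv> \<lambda>w u. w \<bullet> u - real_of_ereal (conjugate f u) - \<delta> * d u"
  shows "\<exists>u\<in>edom (conjugate f). smoothed d \<delta> f w = h w u \<and>
           (\<forall>v\<in>edom (conjugate f). h w v \<le> h w u)"
proof -
  define C where "C = edom (conjugate f)"
  define S where "S = smoothed d \<delta> f w"
  have S_eq: "S = (SUP u\<in>C. h w u)" by (simp add: S_def smoothed_def C_def h_def)
  have dge: "d u \<ge> 1 / 2 * (norm u)\<^sup>2" if "u \<in> C" for u
    using d that by (auto simp: prox_function_def C_def)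
  have C0: "0 \<in> C"
    using d by (auto simp: prox_function_def C_def is_arg_min_def)
  have quad: "h w u \<le> norm w * norm u + f 0 - \<delta> / 2 * (norm u)\<^sup>2" if u: "u \<in> C" for u
  proof -
    have "- f 0 \<le> real_of_ereal (conjugate f u)"
      using real_conjugate_ge[of u f 0] u by (simp add: C_def)
    moreover have "w \<bullet> u \<le> norm w * norm u" by (rule norm_cauchy_schwarz)
    moreover have "\<delta> * d u \<ge> \<delta> * (1 / 2 * (norm u)\<^sup>2)"
      using dge[OF u] \<open>\<delta> > 0\<close> by (intro mult_left_mono) auto
    ultimately show ?thesis unfolding h_def by simp
  qed
  have ub: "h w u \<le> f 0 + (norm w)\<^sup>2 / (2 * \<delta>)" if u: "u \<in> C" for u
  proof -
    have "0 \<le> (\<delta> * norm u - norm w)\<^sup>2 / (2 * \<delta>)" using \<open>\<delta> > 0\<close> by simp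
    also have "\<dots> = \<delta> / 2 * (norm u)\<^sup>2 - norm w * norm u + (norm w)\<^sup>2 / (2 * \<delta>)"
      using \<open>\<delta> > 0\<close> by (simp add: field_simps power2_eq_square)
    finally show ?thesis using quad[OF u] by simp
  qed
  have bdd: "bdd_above (h w ` C)" by (auto intro!: bdd_aboveI2 ub)
  have upper: "h w u \<le> S" if "u \<in> C" for u
    unfolding S_eq by (rule cSUP_upper[OF that bdd])
  have "\<exists>u\<in>C. h w u > S - 1 / real (Suc n)" for n
  proof -
    have "S - 1 / real (Suc n) < (SUP u\<in>C. h w u)" unfolding S_eq[symmetric] by simp
    then show ?thesis using less_cSUP_iff[of C "h w"] C0 bdd by auto
  qed
  then obtain x where xC: "\<And>n. x n \<in> C" and xS: "\<And>n. h w (x n) > S - 1 / real (Suc n)"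
    by metis
  have bounded: "norm (x n) \<le> (2 * norm w + 2 * (\<bar>f 0\<bar> + \<bar>S\<bar> + 1) + \<delta>) / \<delta>" for n
  proof (cases "norm (x n) \<le> 1")
    case True
    have "\<delta> * norm (x n) \<le> \<delta> * 1" using True \<open>\<delta> > 0\<close> by (intro mult_left_mono) auto
    moreover have "0 \<le> 2 * norm w + 2 * (\<bar>f 0\<bar> + \<bar>S\<bar> + 1)" by simp
    ultimately have "\<delta> * norm (x n) \<le> 2 * norm w + 2 * (\<bar>f 0\<bar> + \<bar>S\<bar> + 1) + \<delta>"
      by (smt (verit))
    then show ?thesis using \<open>\<delta> > 0\<close> by (simp add: field_simps)
  next
    case False
    let ?a = "norm (x n)" and ?K = "\<bar>f 0\<bar> + \<bar>S\<bar> + 1"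
    have "1 / real (Suc n) \<le> 1" by simp
    then have "\<delta> / 2 * ?a\<^sup>2 \<le> norm w * ?a + ?K"
      using quad[OF xC[of n]] xS[of n] by linarith
    moreover have "?K \<le> ?K * ?a" using False mult_left_mono[of 1 ?a ?K] by simp
    ultimately have "(\<delta> / 2 * ?a) * ?a \<le> (norm w + ?K) * ?a"
      by (simp add: power2_eq_square algebra_simps)
    then have "\<delta> / 2 * ?a \<le> norm w + ?K"
      using False by (subst (asm) mult_le_cancel_right) auto
    then show ?thesis using \<open>\<delta> > 0\<close> by (simp add: field_simps)
  qed
  then have "bounded (range x)" by (auto simp: bounded_iff)
  then obtain u r where r: "strict_mono r" and lim: "(x \<circ> r) \<longlonglongrightarrow> u"
    using bounded_imp_convergent_subsequence by blast
  have inv: "(\<lambda>n. 1 / real (Suc (r n))) \<longlonglongrightarrow> 0"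
    using LIMSEQ_subseq_LIMSEQ[OF lim_inverse_n'[THEN LIMSEQ_Suc] r]
    by (simp add: o_def)
  have limx: "(\<lambda>n. x (r n)) \<longlonglongrightarrow> u" using lim by (simp add: o_def)
  have val: "x (r n) \<bullet> v - f v \<le> w \<bullet> x (r n) - \<delta> * d (x (r n)) - S + 1 / real (Suc (r n))" for n v
    using real_conjugate_ge[of "x (r n)" f v] xC[of "r n"] xS[of "r n"]
    by (simp add: h_def C_def)
  have "u \<bullet> v - f v \<le> w \<bullet> u - S + 0" for v
  proof (rule LIMSEQ_le)
    show "(\<lambda>n. x (r n) \<bullet> v - f v) \<longlonglongrightarrow> u \<bullet> v - f v" by (intro tendsto_intros limx)
    show "(\<lambda>n. w \<bullet> x (r n) - S + 1 / real (Suc (r n))) \<longlonglongrightarrow> w \<bullet> u - S + 0"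
      by (intro tendsto_intros limx inv)
    have "\<delta> * d (x (r n)) \<ge> 0" for n
      using dge[OF xC[of "r n"]] \<open>\<delta> > 0\<close> by (intro mult_nonneg_nonneg order_trans[OF _ dge[OF xC]]) auto
    then show "\<exists>N. \<forall>n\<ge>N. x (r n) \<bullet> v - f v \<le> w \<bullet> x (r n) - S + 1 / real (Suc (r n))"
      using val[of _ v] by (intro exI[of _ 0] allI impI) (smt (verit))
  qed
  then have uC: "u \<in> C" unfolding C_def by (intro edom_conjugateI) auto
  have "C \<subseteq> D" "continuous_on D d" using d by (auto simp: prox_function_def C_def)
  then have limd: "(\<lambda>n. d (x (r n))) \<longlonglongrightarrow> d u"
    using limx uC xC
    by (intro continuous_on_tendsto_compose[of D d "\<lambda>n. x (r n)" u sequentially])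
      (auto intro!: always_eventually)
  have "u \<bullet> v - f v \<le> w \<bullet> u - \<delta> * d u - S + 0" for v
  proof (rule LIMSEQ_le)
    show "(\<lambda>n. x (r n) \<bullet> v - f v) \<longlonglongrightarrow> u \<bullet> v - f v" by (intro tendsto_intros limx)
    show "(\<lambda>n. w \<bullet> x (r n) - \<delta> * d (x (r n)) - S + 1 / real (Suc (r n)))
            \<longlonglongrightarrow> w \<bullet> u - \<delta> * d u - S + 0"
      by (intro tendsto_intros limx inv limd)
  qed (use val in blast)
  then have "real_of_ereal (conjugate f u) \<le> w \<bullet> u - \<delta> * d u - S + 0"
    by (rule edom_conjugateI(2))
  then have "S \<le> h w u" by (simp add: h_def)
  with upper[OF uC] upper uC show ?thesis
    unfolding S_def[symmetric] C_def[symmetric] by (intro bexI[of _ u]) fastforce+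
qed

end

theory Submission
  imports Defs
begin

text \<open>A subgradient \<open>r\<^sub>k\<close> of \<open>R\<^sub>k\<close> at \<open>w\<^sup>o\<close> lies in the domain of the conjugate, with
  \<open>R\<^sub>k\<^sup>\<star>(r\<^sub>k) = w\<^sup>o \<bullet> r\<^sub>k - R\<^sub>k(w\<^sup>o)\<close>, so that testing the maximum defining the smoothed function
  with \<open>r\<^sub>k\<close> bounds it from below, up to \<open>\<delta> d(r\<^sub>k)\<close>, by the affine minorant of \<open>R\<^sub>k\<close> at \<open>w\<^sup>o\<close> with
  slope \<open>r\<^sub>k\<close>. Adding the strongly convex aggregate of the \<open>J\<^sub>k\<close>, the optimality condition cancels
  all linear terms: the smoothed cost at \<open>w\<close> is at least
  \<open>F(w\<^sup>o) + \<lambda>\<^sub>L/2 \<parallel>w - w\<^sup>o\<parallel>\<^sup>2 - \<delta> \<Sum> p\<^sub>k d(r\<^sub>k)\<close>. At its minimizer it is at most its value at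
  \<open>w\<^sup>o\<close>, hence at most \<open>F(w\<^sup>o)\<close>. The subgradients \<open>r\<^sub>k\<close> come from the sum rule, which
  is obtained by separating an epigraph from a hypograph. Existence of minimizers uses that
  \<open>0 \<in> dom R\<^sub>k\<^sup>\<star>\<close> makes \<open>R\<^sub>k\<close> bounded below.\<close>

section \<open>Elementary subgradient calculus\<close>

lemma subdifferentialI:
  "(\<And>y. f y \<ge> f x + g \<bullet> (y - x)) \<Longrightarrow> g \<in> subdifferential f x"
  by (simp add: subdifferential_def)

lemma subdifferentialD: "g \<in> subdifferential f x \<Longrightarrow> f y \<ge> f x + g \<bullet> (y - x)"
  by (simp add: subdifferential_def)

lemma subdifferential_scaleI:
  assumes "c > 0" "g \<in> subdifferential (\<lambda>x. c * f x) x"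
  shows "(1 / c) *\<^sub>R g \<in> subdifferential f x"
proof (rule subdifferentialI)
  fix y
  have "c * f y \<ge> c * f x + g \<bullet> (y - x)" by (rule subdifferentialD[OF assms(2)])
  then show "f y \<ge> f x + ((1 / c) *\<^sub>R g) \<bullet> (y - x)"
    using assms(1) by (simp add: field_simps)
qed

text \<open>An affine minorant touching \<open>f\<close> at the convex combination \<open>z\<close>,
  averaged over the two endpoints, returns exactly \<open>f z\<close>. This gives convexity wherever
  subgradients are explicit.\<close>

lemma convex_on_if_subdifferential_nonempty:
  assumes "\<And>x. subdifferential f x \<noteq> {}"
  shows "convex_on UNIV f"
proof (rule convex_onI)
  fix t :: real and x y :: 'a
  assume t: "0 < t" "t < 1"
  define z where "z = (1 - t) *\<^sub>R x + t *\<^sub>R y"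
  obtain g where g: "g \<in> subdifferential f z" using assms by blast
  have "(1 - t) * f x \<ge> (1 - t) * (f z + g \<bullet> (x - z))" "t * f y \<ge> t * (f z + g \<bullet> (y - z))"
    using subdifferentialD[OF g] t by (auto intro!: mult_left_mono)
  moreover have "(1 - t) * (f z + g \<bullet> (x - z)) + t * (f z + g \<bullet> (y - z)) = f z"
    by (simp add: z_def algebra_simps inner_simps)
  ultimately show "f ((1 - t) *\<^sub>R x + t *\<^sub>R y) \<le> (1 - t) * f x + t * f y"
    unfolding z_def by linarith
qed simp

section \<open>Separation of convex sets and the sum rule\<close>

text \<open>Strictness keeps this set disjoint from a touching epigraph. It survives convex
  combinations because one weight is positive; when \<open>u = 0\<close>, the other is
  \<open>1\<close>.\<close>

lemma convex_strict_hypograph: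
  assumes "convex_on UNIV g"
  shows "convex {(x, t). t < - g x}"
proof (rule convexI)
  fix a b :: "'a \<times> real" and u v :: real
  assume ab: "a \<in> {(x, t). t < - g x}" "b \<in> {(x, t). t < - g x}"
    and uv: "0 \<le> u" "0 \<le> v" "u + v = 1"
  obtain x s y t where [simp]: "a = (x, s)" "b = (y, t)" by (metis surj_pair)
  have "g (u *\<^sub>R x + v *\<^sub>R y) \<le> u * g x + v * g y"
    using assms uv unfolding convex_on_def by auto
  moreover have "u * s + v * t < - (u * g x + v * g y)"
  proof (cases "u = 0")
    case True then show ?thesis using ab uv by simp
  next
    case False
    then have "u * s < u * (- g x)" using ab uv by (intro mult_strict_left_mono) auto
    moreover have "v * t \<le> v * (- g y)" using ab uv by (intro mult_left_mono) auto
    ultimately show ?thesis by simp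
  qed
  ultimately show "u *\<^sub>R a + v *\<^sub>R b \<in> {(x, t). t < - g x}" by simp
qed

text \<open>Minimality at \<open>x0\<close> puts \<open>f - f x0\<close> above
  \<open>-(g - g x0)\<close>, with contact at \<open>x0\<close>. A hyperplane between the two graphs
  has the desired \<open>r\<close> as its slope.\<close>

lemma convex_sandwich:
  fixes f g :: "'a::euclidean_space \<Rightarrow> real"
  assumes f: "convex_on UNIV f" and g: "convex_on UNIV g"
    and ge: "\<And>x. f x + g x \<ge> f x0 + g x0"
  shows "\<exists>r. r \<in> subdifferential f x0 \<and> - r \<in> subdifferential g x0"
proof -
  define A where "A = epigraph UNIV (\<lambda>x. f x - f x0)"
  define B where "B = {(x, t). t < - (g x - g x0)}"
  have shift: "convex_on UNIV (\<lambda>x. h x - c)" if "convex_on UNIV h" for h :: "'a \<Rightarrow> real" and c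
    using convex_on_add[OF that, of "\<lambda>_. - c"] by (simp add: convex_on_const)
  have "convex A" unfolding A_def convex_epigraph by (rule shift[OF f])
  moreover have "convex B" unfolding B_def by (rule convex_strict_hypograph[OF shift[OF g]])
  moreover have "(x0, 0) \<in> A" "(x0, -1) \<in> B" by (auto simp: A_def B_def epigraph_def)
  moreover have "A \<inter> B = {}"
  proof -
    have False if "(x, t) \<in> A" "(x, t) \<in> B" for x t
      using that ge[of x] by (auto simp: A_def B_def epigraph_def)
    then show ?thesis by auto
  qed
  ultimately obtain c b where c: "c \<noteq> 0"
    and A: "\<And>z. z \<in> A \<Longrightarrow> c \<bullet> z \<le> b" and B: "\<And>z. z \<in> B \<Longrightarrow> c \<bullet> z \<ge> b"
    using separating_hyperplane_sets[of A B] by blast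
  obtain a s where [simp]: "c = (a, s)" by (metis surj_pair)
  have A': "a \<bullet> x + s * t \<le> b" if "t \<ge> f x - f x0" for x t
    using A[of "(x, t)"] that by (simp add: A_def epigraph_def)
  have B': "a \<bullet> x + s * t \<ge> b" if "t < - (g x - g x0)" for x t
    using B[of "(x, t)"] that by (simp add: B_def)
  \<comment> \<open>This is the limit of \<open>B'\<close> as \<open>t\<close> rises to the excluded
    boundary. The choice of \<open>q\<close> makes the loss at most \<open>e\<close>, and the added
    \<open>1\<close> covers \<open>s = 0\<close>.\<close>
  have b_lower: "a \<bullet> x - s * (g x - g x0) \<ge> b" for x
  proof (rule field_le_epsilon)
    fix e :: real
    assume "e > 0"
    define q where "q = e / (\<bar>s\<bar> + 1)"
    have "q > 0" using \<open>e > 0\<close> by (simp add: q_def add_nonneg_pos)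
    have "\<bar>s\<bar> * q \<le> (\<bar>s\<bar> + 1) * q" using \<open>q > 0\<close> by (simp add: algebra_simps)
    also have "\<dots> = e" by (simp add: q_def add_nonneg_eq_0_iff)
    finally have "- s * q \<le> e"
      using \<open>q > 0\<close> abs_ge_minus_self[of s] mult_right_mono[of "- s" "\<bar>s\<bar>" q] by linarith
    moreover have "a \<bullet> x + s * (- (g x - g x0) - q) \<ge> b" using \<open>q > 0\<close> by (intro B') simp
    ultimately show "b \<le> a \<bullet> x - s * (g x - g x0) + e" by (simp add: algebra_simps)
  qed
  have bx0: "a \<bullet> x0 = b" using A'[of x0 0] b_lower[of x0] by simp
  have "s \<le> 0" using A'[of x0 1] bx0 by simp
  \<comment> \<open>The epigraph of \<open>f\<close> lies over every point, in particular over
    \<open>x0 + a\<close>, so a vertical separating hyperplane would have zero normal.\<close>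
  moreover have "s \<noteq> 0"
  proof
    assume "s = 0"
    then have "a \<bullet> (x0 + a) \<le> a \<bullet> x0" using A'[OF order_refl, of "x0 + a"] bx0 by simp
    then have "a \<bullet> a \<le> 0" by (simp add: inner_simps)
    then have "a = 0" by (metis inner_gt_zero_iff not_le)
    with \<open>s = 0\<close> c show False by (simp add: zero_prod_def)
  qed
  ultimately have s: "s < 0" by simp
  \<comment> \<open>Solving \<open>a \<bullet> x + s * t = b\<close> for \<open>t\<close> gives an
    affine function of \<open>x\<close> with slope \<open>r\<close>.\<close>
  define r where "r = (- 1 / s) *\<^sub>R a"
  have a: "a = (- s) *\<^sub>R r" using s by (simp add: r_def)
  show ?thesis
  proof (intro exI conjI subdifferentialI)
    fix y
    have "(- s) * (r \<bullet> (y - x0)) \<le> (- s) * (f y - f x0)"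
      using A'[OF order_refl, of y] bx0 by (simp add: a inner_simps algebra_simps)
    from mult_left_le_imp_le[OF this] s show "f x0 + r \<bullet> (y - x0) \<le> f y" by simp
    have "(- s) * (- (r \<bullet> (y - x0))) \<le> (- s) * (g y - g x0)"
      using b_lower[of y] bx0 by (simp add: a inner_simps algebra_simps)
    from mult_left_le_imp_le[OF this] s show "g x0 + (- r) \<bullet> (y - x0) \<le> g y" by simp
  qed
qed

text \<open>Tilting \<open>g\<close> by \<open>- s\<close> turns the subgradient condition into
  minimality at \<open>x0\<close>, to which \<open>convex_sandwich\<close> applies.\<close>

lemma subdifferential_add:
  fixes f g :: "'a::euclidean_space \<Rightarrow> real"
  assumes f: "convex_on UNIV f" and g: "convex_on UNIV g"
    and s: "s \<in> subdifferential (\<lambda>x. f x + g x) x0"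
  shows "\<exists>r\<in>subdifferential f x0. s - r \<in> subdifferential g x0"
proof -
  have "convex_on UNIV (\<lambda>x. - s \<bullet> x)" by (simp add: convex_on_def inner_simps)
  then have "convex_on UNIV (\<lambda>x. g x + - s \<bullet> x)" by (rule convex_on_add[OF g])
  moreover have "f x + (g x + - s \<bullet> x) \<ge> f x0 + (g x0 + - s \<bullet> x0)" for x
    using subdifferentialD[OF s, of x] by (simp add: inner_simps)
  ultimately obtain r where r: "r \<in> subdifferential f x0"
    and r': "- r \<in> subdifferential (\<lambda>x. g x + - s \<bullet> x) x0"
    using convex_sandwich[OF f] by blast
  have "s - r \<in> subdifferential g x0"
  proof (rule subdifferentialI)
    fix y
    show "g x0 + (s - r) \<bullet> (y - x0) \<le> g y"
      using subdifferentialD[OF r', of y] by (simp add: inner_simps)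
  qed
  with r show ?thesis by blast
qed

lemma convex_on_sum_fun:
  fixes f :: "'i \<Rightarrow> 'a::real_vector \<Rightarrow> real"
  assumes "finite I" "convex S" "\<And>i. i \<in> I \<Longrightarrow> convex_on S (f i)"
  shows "convex_on S (\<lambda>x. \<Sum>i\<in>I. f i x)"
  using assms by (induction I rule: finite_induct) (auto simp: convex_on_const)

lemma subdifferential_sum:
  fixes f :: "'i \<Rightarrow> 'a::euclidean_space \<Rightarrow> real"
  assumes "finite I" and "\<And>i. i \<in> I \<Longrightarrow> convex_on UNIV (f i)"
    and "s \<in> subdifferential (\<lambda>x. \<Sum>i\<in>I. f i x) x0"
  shows "\<exists>r. (\<forall>i\<in>I. r i \<in> subdifferential (f i) x0) \<and> s = (\<Sum>i\<in>I. r i)"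
  using assms
proof (induction I arbitrary: s rule: finite_induct)
  case empty
  \<comment> \<open>The empty sum is the zero function; its subgradient is tested along its own
    direction.\<close>
  then have "s \<bullet> s \<le> 0"
    using subdifferentialD[OF empty.prems(2), of "x0 + s"] by simp
  then have "s = 0" by (metis inner_gt_zero_iff not_le)
  then show ?case by simp
next
  case (insert i I)
  have "convex_on UNIV (\<lambda>x. \<Sum>i\<in>I. f i x)"
    using insert by (intro convex_on_sum_fun) auto
  then obtain q where q: "q \<in> subdifferential (f i) x0"
      "s - q \<in> subdifferential (\<lambda>x. \<Sum>i\<in>I. f i x) x0"
    using subdifferential_add[of "f i" "\<lambda>x. \<Sum>i\<in>I. f i x" s x0] insert by auto
  then obtain r where r: "\<forall>i\<in>I. r i \<in> subdifferential (f i) x0" "s - q = (\<Sum>i\<in>I. r i)"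
    using insert by blast
  have "(\<Sum>j\<in>I. (r(i := q)) j) = (\<Sum>j\<in>I. r j)"
    using insert by (intro sum.cong) auto
  then have "s = (\<Sum>j\<in>insert i I. (r(i := q)) j)"
    using insert r(2) by (simp add: algebra_simps)
  with q r show ?case by (intro exI[of _ "r(i := q)"]) auto
qed

section \<open>Gradients and strong monotonicity\<close>

text \<open>Subtracting the linear form of \<open>r\<close> leaves a function minimal at
  \<open>x\<close>, so its derivative vanishes there; evaluating it at \<open>g - r\<close> gives
  the squared distance.\<close>

lemma subgradient_eq_gradient:
  assumes "GDERIV f x :> g" and r: "r \<in> subdifferential f x"
  shows "r = g"
proof -
  have "((\<lambda>y. f y - r \<bullet> y) has_derivative (\<lambda>h. h \<bullet> g - r \<bullet> h)) (at x)"
    using assms(1) unfolding gderiv_def by (auto intro!: derivative_intros)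
  moreover have "f x - r \<bullet> x \<le> f y - r \<bullet> y" for y
    using subdifferentialD[OF r, of y] by (simp add: inner_simps)
  ultimately have "(\<lambda>h. h \<bullet> g - r \<bullet> h) = (\<lambda>h. 0)"
    by (intro differential_zero_maxmin[of x UNIV]) auto
  then have "(g - r) \<bullet> g - r \<bullet> (g - r) = 0" by meson
  then have "(g - r) \<bullet> (g - r) = 0" by (simp add: inner_simps inner_commute)
  then show ?thesis by simp
qed

text \<open>Converts monotonicity of the gradient into quadratic growth by following
  \<open>f\<close> along the segment from \<open>x\<close> to \<open>y\<close>.\<close>

lemma strongly_monotone_gradient_lower_bound:
  fixes f :: "'a::real_inner \<Rightarrow> real"
  assumes der: "\<And>x. GDERIV f x :> G x"
    and mono: "\<And>x y. (x - y) \<bullet> (G x - G y) \<ge> \<mu> * (norm (x - y))\<^sup>2"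
  shows "f y \<ge> f x + G x \<bullet> (y - x) + \<mu> / 2 * (norm (y - x))\<^sup>2"
proof -
  define v where "v = y - x"
  \<comment> \<open>Up to the constant \<open>f x\<close>, the gap between \<open>f\<close> and the
    claimed minorant along the segment; the claim is \<open>\<psi> 0 \<le> \<psi> 1\<close>.\<close>
  define \<psi> where "\<psi> t = f (x + t *\<^sub>R v) - t * (G x \<bullet> v) - \<mu> / 2 * (norm v)\<^sup>2 * t\<^sup>2" for t
  have "\<psi> 0 \<le> \<psi> 1"
  proof (rule DERIV_nonneg_imp_nondecreasing[where f = \<psi>])
    fix t :: real
    assume t: "0 \<le> t" "t \<le> 1"
    let ?D = "v \<bullet> G (x + t *\<^sub>R v) - G x \<bullet> v - \<mu> * (norm v)\<^sup>2 * t"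
    have "((\<lambda>t. x + t *\<^sub>R v) has_derivative (\<lambda>h. h *\<^sub>R v)) (at t)"
      by (auto intro!: derivative_eq_intros)
    from has_derivative_compose[OF this der[of "x + t *\<^sub>R v", unfolded gderiv_def]]
    have "((\<lambda>t. f (x + t *\<^sub>R v)) has_field_derivative (v \<bullet> G (x + t *\<^sub>R v))) (at t)"
      unfolding has_field_derivative_def by (simp add: mult.commute[of _ "v \<bullet> _"])
    then have "(\<psi> has_field_derivative ?D) (at t)"
      unfolding \<psi>_def by (auto intro!: derivative_eq_intros)
    moreover have "?D \<ge> 0"
    \<comment> \<open>Monotonicity for \<open>x + t *\<^sub>R v\<close> and \<open>x\<close> carries
      a factor \<open>t\<close> to be divided out; at \<open>t = 0\<close> the derivative
      \<open>?D\<close> is zero.\<close>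
    proof (cases "t = 0")
      case False
      have "t * (t * (\<mu> * (norm v)\<^sup>2)) \<le> t * (v \<bullet> (G (x + t *\<^sub>R v) - G x))"
        using mono[of "x + t *\<^sub>R v" x] t by (simp add: power_mult_distrib power2_eq_square mult_ac)
      then have "t * (\<mu> * (norm v)\<^sup>2) \<le> v \<bullet> (G (x + t *\<^sub>R v) - G x)"
        using t False by (simp add: mult_le_cancel_left)
      then show ?thesis by (simp add: inner_simps inner_commute mult_ac)
    qed (simp add: inner_commute)
    ultimately show "\<exists>y. (\<psi> has_real_derivative y) (at t) \<and> 0 \<le> y" by blast
  qed simp
  then show ?thesis by (simp add: \<psi>_def v_def)
qed

lemma convex_on_if_quadratic_lower_bound:
  fixes f :: "'a::real_inner \<Rightarrow> real"
  assumes "\<mu> \<ge> 0"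
    and lower: "\<And>x y. f y \<ge> f x + G x \<bullet> (y - x) + \<mu> / 2 * (norm (y - x))\<^sup>2"
  shows "convex_on UNIV f"
proof (rule convex_on_if_subdifferential_nonempty)
  fix x
  have "G x \<in> subdifferential f x"
  proof (rule subdifferentialI)
    fix y
    have "\<mu> / 2 * (norm (y - x))\<^sup>2 \<ge> 0" using \<open>\<mu> \<ge> 0\<close> by simp
    with lower[of x y] show "f x + G x \<bullet> (y - x) \<le> f y" by linarith
  qed
  then show "subdifferential f x \<noteq> {}" by blast
qed

section \<open>Existence and uniqueness of minimizers\<close>

text \<open>Quadratic growth of \<open>f\<close> beats the lower bound on \<open>h\<close> outside a
  ball, and a continuous function attains its minimum on that ball. Uniqueness comes from the
  midpoint of two minimizers.\<close>

lemma strongly_convex_plus_convex_ex1_min: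
  fixes f h :: "'a::euclidean_space \<Rightarrow> real"
  assumes \<mu>: "\<mu> > 0"
    and lower: "\<And>x y. f y \<ge> f x + G x \<bullet> (y - x) + \<mu> / 2 * (norm (y - x))\<^sup>2"
    and h: "convex_on UNIV h" and bdd: "\<And>x. h x \<ge> m"
  shows "\<exists>!w. is_arg_min (\<lambda>x. f x + h x) (\<lambda>_. True) w"
proof -
  define F where "F x = f x + h x" for x
  have f: "convex_on UNIV f" by (rule convex_on_if_quadratic_lower_bound[OF less_imp_le[OF \<mu>] lower])
  have F: "convex_on UNIV F" unfolding F_def by (rule convex_on_add[OF f h])
  then have cont: "continuous_on UNIV F" by (rule convex_on_continuous[OF open_UNIV])
  \<comment> \<open>Beyond \<open>K\<close>, \<open>\<mu> / 2 * norm x\<close> exceeds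
    \<open>norm (G 0) + \<bar>h 0 - m\<bar>\<close>. The added \<open>1\<close> gives
    \<open>norm x \<ge> 1\<close>, so the constant \<open>\<bar>h 0 - m\<bar>\<close> is absorbed
    into its multiple by \<open>norm x\<close>.\<close>
  define K where "K = 2 / \<mu> * (norm (G 0) + \<bar>h 0 - m\<bar>) + 1"
  have "2 / \<mu> * (norm (G 0) + \<bar>h 0 - m\<bar>) \<ge> 0" using \<mu> by simp
  then have K1: "K \<ge> 1" by (simp add: K_def)
  have far: "F x > F 0" if "norm x > K" for x
  proof -
    let ?n = "norm x"
    have n1: "?n \<ge> 1" using that K1 by simp
    have "2 / \<mu> * (norm (G 0) + \<bar>h 0 - m\<bar>) < ?n" using that by (simp add: K_def)
    then have "norm (G 0) + \<bar>h 0 - m\<bar> < \<mu> / 2 * ?n" using \<mu> by (simp add: field_simps)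
    then have "(norm (G 0) + \<bar>h 0 - m\<bar>) * ?n < (\<mu> / 2 * ?n) * ?n"
      using n1 by (intro mult_strict_right_mono) auto
    moreover have "\<bar>h 0 - m\<bar> \<le> \<bar>h 0 - m\<bar> * ?n" using n1 mult_left_mono[of 1 ?n] by simp
    moreover have "G 0 \<bullet> x \<ge> - (norm (G 0) * ?n)"
      using Cauchy_Schwarz_ineq2[of "G 0" x] by simp
    ultimately show ?thesis
      using lower[where x=0 and y=x] bdd[of x] by (simp add: F_def power2_eq_square algebra_simps)
  qed
  obtain w where w: "w \<in> cball 0 K" "\<forall>y\<in>cball 0 K. F w \<le> F y"
    using continuous_attains_inf[of "cball 0 K" F] K1 cont
    by (metis compact_cball cball_eq_empty continuous_on_subset subset_UNIV not_le order.strict_trans2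
        zero_le_one not_one_le_zero)
  have w_min: "F w \<le> F y" for y
  proof (cases "norm y \<le> K")
    case False
    then have "F 0 < F y" by (intro far) simp
    moreover have "F w \<le> F 0" using w(2) K1 by simp
    ultimately show ?thesis by simp
  qed (use w in auto)
  have unique: "x = w" if x: "\<And>y. F x \<le> F y" for x
  proof -
    \<comment> \<open>Seen from the midpoint, \<open>x\<close> and \<open>w\<close> lie in opposite
      directions, so the linear terms of the two lower bounds cancel.\<close>
    define z where "z = (1 / 2) *\<^sub>R (x + w)"
    have "x - z = (1 / 2) *\<^sub>R (x - w)" "w - z = - ((1 / 2) *\<^sub>R (x - w))"
      by (simp_all add: z_def algebra_simps flip: scaleR_left_distrib)
    moreover from this have "f x + f w \<ge> 2 * f z + \<mu> * (norm ((1 / 2) *\<^sub>R (x - w)))\<^sup>2"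
      using lower[of z x] lower[of z w] by simp
    moreover have "h z \<le> h x / 2 + h w / 2"
      using convex_onD[OF h, of "1/2" x w] by (simp add: z_def scaleR_add_right)
    moreover have "F x = F w" "F w \<le> F z" using x[of w] w_min by (auto intro: antisym)
    ultimately have "\<mu> * (norm ((1 / 2) *\<^sub>R (x - w)))\<^sup>2 \<le> 0" unfolding F_def by linarith
    then show ?thesis using \<mu> by (simp add: mult_le_0_iff)
  qed
  show ?thesis
    unfolding is_arg_min_linorder F_def[symmetric] using w_min unique by (intro ex1I[of _ w]) auto
qed

section \<open>Proximity functions and the smoothed function\<close>

lemma prox_function_nonneg: "prox_function d D C \<Longrightarrow> u \<in> C \<Longrightarrow> d u \<ge> 0"
  unfolding prox_function_def by (meson order_trans zero_le_power2 mult_nonneg_nonneg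
      zero_le_divide_1_iff zero_le_numeral)

lemma prox_function_zero_mem: "prox_function d D C \<Longrightarrow> 0 \<in> C"
  by (auto simp: prox_function_def is_arg_min_def)

context
  fixes f :: "'a::euclidean_space \<Rightarrow> real" and d D and \<delta> :: real
  assumes prox: "prox_function d D (edom (conjugate f))" and \<delta>: "\<delta> > 0"
begin

lemma smoothed_ge:
  assumes "u \<in> edom (conjugate f)"
  shows "smoothed d \<delta> f w \<ge> w \<bullet> u - real_of_ereal (conjugate f u) - \<delta> * d u"
  using smoothed_attained[OF prox \<delta>, of w] assms by auto

text \<open>The Fenchel-Young inequality at the maximizer, after dropping the nonnegative proximity
  term.\<close>

lemma smoothed_le: "smoothed d \<delta> f w \<le> f w"
proof -
  obtain u where u: "u \<in> edom (conjugate f)"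
    "smoothed d \<delta> f w = w \<bullet> u - real_of_ereal (conjugate f u) - \<delta> * d u"
    using smoothed_attained[OF prox \<delta>, of w] by blast
  moreover have "\<delta> * d u \<ge> 0" using prox_function_nonneg[OF prox u(1)] \<delta> by simp
  ultimately show ?thesis using real_conjugate_ge[OF u(1), of w] by (simp add: inner_commute)
qed

text \<open>The maximizer at \<open>w\<close> is the slope of an affine minorant that is active at
  \<open>w\<close>, hence a subgradient.\<close>

lemma convex_on_smoothed: "convex_on UNIV (smoothed d \<delta> f)"
proof (rule convex_on_if_subdifferential_nonempty)
  fix w
  obtain u where u: "u \<in> edom (conjugate f)"
    "smoothed d \<delta> f w = w \<bullet> u - real_of_ereal (conjugate f u) - \<delta> * d u"
    using smoothed_attained[OF prox \<delta>, of w] by blast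
  have "u \<in> subdifferential (smoothed d \<delta> f) w"
  proof (rule subdifferentialI)
    fix y
    show "smoothed d \<delta> f w + u \<bullet> (y - w) \<le> smoothed d \<delta> f y"
      using smoothed_ge[OF u(1), of y] u(2) by (simp add: inner_simps inner_commute)
  qed
  then show "subdifferential (smoothed d \<delta> f) w \<noteq> {}" by blast
qed

lemma smoothed_ge_subgradient:
  assumes r: "r \<in> subdifferential f x"
  shows "smoothed d \<delta> f w \<ge> f x + r \<bullet> (w - x) - \<delta> * d r"
proof -
  have "r \<bullet> v - f v \<le> r \<bullet> x - f x" for v
    using subdifferentialD[OF r, of v] by (simp add: inner_simps)
  from edom_conjugateI[OF this] smoothed_ge[of r w] show ?thesis
    by (simp add: inner_simps inner_commute)
qed

text \<open>Testing with \<open>u = 0\<close>, where \<open>d\<close> vanishes, gives a bound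
  independent of both \<open>w\<close> and \<delta>.\<close>

lemma smoothed_bounded_below: "smoothed d \<delta> f w \<ge> - real_of_ereal (conjugate f 0)"
  using smoothed_ge[OF prox_function_zero_mem[OF prox], of w] prox by (simp add: prox_function_def)

end

section \<open>Optimality conditions and the smoothing bias\<close>

theorem theorem2:
  fixes N :: nat
    and p :: "nat \<Rightarrow> real"
    and J R :: "nat \<Rightarrow> real ^ 'm \<Rightarrow> real"
    and gradJ :: "nat \<Rightarrow> real ^ 'm \<Rightarrow> real ^ 'm"
    and d :: "real ^ 'm \<Rightarrow> real"
    and D :: "(real ^ 'm) set"
    and lU lL :: real
    and wo :: "real ^ 'm"
    and wd :: "real \<Rightarrow> real ^ 'm"
  defines "F \<equiv> \<lambda>w. \<Sum>k=1..N. p k * (J k w + R k w)"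
    and "Fs \<equiv> \<lambda>\<delta> w. \<Sum>k=1..N. p k * (J k w + smoothed d \<delta> (R k) w)"
  assumes "N \<ge> 1"
    and "\<forall>k\<in>{1..N}. p k > 0"
    and "(\<Sum>k=1..N. p k) = 1"
    and "\<forall>k\<in>{1..N}. \<forall>x. GDERIV (J k) x :> gradJ k x"
    and "\<forall>k\<in>{1..N}. \<forall>x y. norm (gradJ k x - gradJ k y) \<le> lU * norm (x - y)"
    and "lL > 0"
    and "\<forall>x y. (x - y) \<bullet> (\<Sum>k=1..N. p k *\<^sub>R (gradJ k x - gradJ k y)) \<ge> lL * (norm (x - y))\<^sup>2"
    and "\<forall>k\<in>{1..N}. closed_convex_fun (R k)"
    and "\<forall>k\<in>{1..N}. prox_function d D (edom (conjugate (R k)))"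
    and "wo = (ARG_MIN F w. True)"
    and "\<forall>\<delta>>0. wd \<delta> = (ARG_MIN (Fs \<delta>) w. True)"
  shows "(\<exists>!w. is_arg_min F (\<lambda>_. True) w) \<and>
    (\<forall>\<delta>>0. \<exists>!w. is_arg_min (Fs \<delta>) (\<lambda>_. True) w) \<and>
    (\<exists>r. (\<forall>k\<in>{1..N}. r k \<in> subdifferential (R k) wo) \<and>
         (\<Sum>k=1..N. p k *\<^sub>R (gradJ k wo + r k)) = 0) \<and>
    (\<forall>r. (\<forall>k\<in>{1..N}. r k \<in> subdifferential (R k) wo) \<and>
         (\<Sum>k=1..N. p k *\<^sub>R (gradJ k wo + r k)) = 0 \<longrightarrow>
         (\<forall>\<delta>>0. (norm (wo - wd \<delta>))\<^sup>2 \<le> \<delta> * (2 / lL) * (\<Sum>k=1..N. p k * d (r k)))) \<and>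
    (\<lambda>\<delta>. (norm (wo - wd \<delta>))\<^sup>2) \<in> O[at_right 0](\<lambda>\<delta>. \<delta>)"
proof -
  note p = assms(4) and J = assms(6) and lL = assms(8)
    and mono = assms(9) and R = assms(10) and prox = assms(11) and wo = assms(12) and wd = assms(13)
  define Jb where "Jb w = (\<Sum>k=1..N. p k * J k w)" for w
  define G where "G w = (\<Sum>k=1..N. p k *\<^sub>R gradJ k w)" for w
  define H where "H w = (\<Sum>k=1..N. p k * R k w)" for w
  define Hs where "Hs \<delta> w = (\<Sum>k=1..N. p k * smoothed d \<delta> (R k) w)" for \<delta> w
  \<comment> \<open>A lower bound for \<open>H\<close> and for every \<open>Hs \<delta>\<close> with
    \<delta> positive, since \<open>- real_of_ereal (conjugate (R k) 0)\<close> bounds both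
    \<open>R k\<close> and its smoothing from below.\<close>
  define m where "m = (\<Sum>k=1..N. p k * - real_of_ereal (conjugate (R k) 0))"
  have F: "F = (\<lambda>w. Jb w + H w)" and Fs: "Fs \<delta> = (\<lambda>w. Jb w + Hs \<delta> w)" for \<delta>
    by (auto simp: F_def Fs_def Jb_def H_def Hs_def algebra_simps sum.distrib)
  have Jb: "GDERIV Jb x :> G x" for x
    unfolding gderiv_def Jb_def G_def inner_sum_right inner_scaleR_right
    using J by (intro has_derivative_sum has_derivative_mult_right) (auto simp: gderiv_def)
  have "(x - y) \<bullet> (G x - G y) \<ge> lL * (norm (x - y))\<^sup>2" for x y
    using mono by (simp add: G_def sum_subtractf scaleR_diff_right)
  note lower = strongly_monotone_gradient_lower_bound[OF Jb this]
  have Rconv: "convex_on UNIV (\<lambda>w. p k * R k w)" if "k \<in> {1..N}" for k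
    using that R p by (intro convex_on_cmul) (auto simp: closed_convex_fun_def less_imp_le)
  have H: "convex_on UNIV H"
    unfolding H_def using Rconv by (intro convex_on_sum_fun) auto
  have Hs: "convex_on UNIV (Hs \<delta>)" if "\<delta> > 0" for \<delta>
    unfolding Hs_def using p prox that
    by (intro convex_on_sum_fun convex_on_cmul convex_on_smoothed[of d D])
      (auto simp: less_imp_le)
  have "H w \<ge> m" for w
    unfolding H_def m_def
  proof (intro sum_mono mult_left_mono)
    fix k assume k: "k \<in> {1..N}"
    show "p k \<ge> 0" using p k by (auto simp: less_imp_le)
    have "0 \<in> edom (conjugate (R k))" using prox k by (auto intro: prox_function_zero_mem)
    from real_conjugate_ge[OF this, of w] show "- real_of_ereal (conjugate (R k) 0) \<le> R k w" by simp
  qed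
  then have ex1: "\<exists>!w. is_arg_min F (\<lambda>_. True) w"
    unfolding F by (rule strongly_convex_plus_convex_ex1_min[OF lL lower H])
  have ex1s: "\<exists>!w. is_arg_min (Fs \<delta>) (\<lambda>_. True) w" if "\<delta> > 0" for \<delta>
  proof -
    have "Hs \<delta> w \<ge> m" for w
      unfolding Hs_def m_def using p prox that
      by (intro sum_mono mult_left_mono smoothed_bounded_below[of d D]) (auto simp: less_imp_le)
    then show ?thesis
      unfolding Fs by (rule strongly_convex_plus_convex_ex1_min[OF lL lower Hs[OF that]])
  qed
  \<comment> \<open>\<open>ARG_MIN\<close> is a choice operator, so existence is what makes the
    chosen point a minimizer.\<close>
  have wo_min: "F wo \<le> F w" for w
    using ex1 someI_ex[of "is_arg_min F (\<lambda>_. True)"]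
    unfolding wo arg_min_def is_arg_min_linorder by blast
  have wd_min: "Fs \<delta> (wd \<delta>) \<le> Fs \<delta> w" if "\<delta> > 0" for \<delta> w
    using ex1s[OF that] someI_ex[of "is_arg_min (Fs \<delta>) (\<lambda>_. True)"] wd that
    unfolding arg_min_def is_arg_min_linorder by metis
  \<comment> \<open>Sandwiching at \<open>wo\<close> yields opposite subgradients of
    \<open>Jb\<close> and \<open>H\<close>; differentiability then identifies the first as
    \<open>G wo\<close>.\<close>
  have "convex_on UNIV Jb" by (rule convex_on_if_quadratic_lower_bound[OF less_imp_le[OF lL] lower])
  then obtain g where g: "g \<in> subdifferential Jb wo" "- g \<in> subdifferential H wo"
    using convex_sandwich[OF _ H, of Jb wo] wo_min unfolding F by blast
  have "g = G wo" by (rule subgradient_eq_gradient[OF Jb g(1)])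
  with g(2) have "- G wo \<in> subdifferential (\<lambda>w. \<Sum>k=1..N. p k * R k w) wo"
    unfolding H_def by simp
  then obtain q where q: "\<forall>k\<in>{1..N}. q k \<in> subdifferential (\<lambda>w. p k * R k w) wo"
      "- G wo = (\<Sum>k=1..N. q k)"
    using subdifferential_sum[of "{1..N}" "\<lambda>k w. p k * R k w", OF finite_atLeastAtMost Rconv] by blast
  have ex_r: "\<exists>r. (\<forall>k\<in>{1..N}. r k \<in> subdifferential (R k) wo) \<and>
         (\<Sum>k=1..N. p k *\<^sub>R (gradJ k wo + r k)) = 0"
  proof (intro exI conjI ballI)
    fix k assume "k \<in> {1..N}"
    then show "(1 / p k) *\<^sub>R q k \<in> subdifferential (R k) wo"
      using p q(1) by (auto intro!: subdifferential_scaleI)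
  next
    \<comment> \<open>The sum rule gives subgradients of the weighted functions; the positive
      weights are divided out and cancel here.\<close>
    have "(\<Sum>k=1..N. p k *\<^sub>R (gradJ k wo + (1 / p k) *\<^sub>R q k))
        = (\<Sum>k=1..N. p k *\<^sub>R gradJ k wo + q k)"
      using p by (intro sum.cong) (force simp: scaleR_add_right)+
    also have "\<dots> = G wo + (\<Sum>k=1..N. q k)" by (simp add: sum.distrib G_def)
    also have "\<dots> = 0" unfolding q(2)[symmetric] by simp
    finally show "(\<Sum>k=1..N. p k *\<^sub>R (gradJ k wo + (1 / p k) *\<^sub>R q k)) = 0" .
  qed
  have bound: "(norm (wo - wd \<delta>))\<^sup>2 \<le> \<delta> * (2 / lL) * (\<Sum>k=1..N. p k * d (r k))"
    if r: "\<forall>k\<in>{1..N}. r k \<in> subdifferential (R k) wo"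
      and opt: "(\<Sum>k=1..N. p k *\<^sub>R (gradJ k wo + r k)) = 0" and \<delta>: "\<delta> > 0" for r \<delta>
  proof -
    let ?z = "wd \<delta>" and ?S = "\<Sum>k=1..N. p k * d (r k)"
    have "H wo + (\<Sum>k=1..N. p k *\<^sub>R r k) \<bullet> (?z - wo) - \<delta> * ?S
        = (\<Sum>k=1..N. p k * (R k wo + r k \<bullet> (?z - wo) - \<delta> * d (r k)))"
      by (simp add: H_def inner_sum_left sum.distrib sum_subtractf sum_distrib_left algebra_simps)
    also have "\<dots> \<le> Hs \<delta> ?z"
      unfolding Hs_def using p r prox \<delta>
      by (intro sum_mono mult_left_mono smoothed_ge_subgradient[of d D]) (auto simp: less_imp_le)
    finally have "H wo + (\<Sum>k=1..N. p k *\<^sub>R r k) \<bullet> (?z - wo) - \<delta> * ?S \<le> Hs \<delta> ?z" .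
    moreover have "(\<Sum>k=1..N. p k *\<^sub>R r k) = - G wo"
      using opt by (simp add: G_def scaleR_add_right sum.distrib eq_neg_iff_add_eq_0 add.commute)
    moreover have "Hs \<delta> wo \<le> H wo"
      unfolding Hs_def H_def using p prox \<delta>
      by (intro sum_mono mult_left_mono smoothed_le[of d D]) (auto simp: less_imp_le)
    moreover have "Jb ?z + Hs \<delta> ?z \<le> Jb wo + Hs \<delta> wo" using wd_min[OF \<delta>, of wo] by (simp add: Fs)
    \<comment> \<open>By optimality the linear term from \<open>H\<close> is opposite to the one in
      \<open>lower\<close>, and the values at \<open>wo\<close> cancel as well.\<close>
    ultimately have "lL / 2 * (norm (?z - wo))\<^sup>2 \<le> \<delta> * ?S" using lower[of wo ?z] by simp
    then show ?thesis using lL by (simp add: field_simps norm_minus_commute)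
  qed
  obtain r where r: "\<forall>k\<in>{1..N}. r k \<in> subdifferential (R k) wo"
      "(\<Sum>k=1..N. p k *\<^sub>R (gradJ k wo + r k)) = 0"
    using ex_r by blast
  have "(\<lambda>\<delta>. (norm (wo - wd \<delta>))\<^sup>2) \<in> O[at_right 0](\<lambda>\<delta>. \<delta>)"
  proof (rule bigoI)
    \<comment> \<open>The subgradients are fixed at \<open>wo\<close> before \<delta> is chosen, so
      the constant does not depend on \<delta>.\<close>
    show "\<forall>\<^sub>F \<delta> in at_right 0. norm ((norm (wo - wd \<delta>))\<^sup>2)
        \<le> (2 / lL * (\<Sum>k=1..N. p k * d (r k))) * norm \<delta>"
      using bound[OF r] by (auto simp: mult_ac intro: eventually_mono[OF eventually_at_right_less])
  qed
  with ex1 ex1s ex_r bound show ?thesis by blast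
qed

end
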